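(* Let $p$ be a prime and let $F_p(n)$ denote the number of binomial coefficients $\binom{m}{k}$ with $0\le k\le m<n$ that are not divisible by $p$ (so $F_p(0)=0$). Then $F_p(j)=\binom{j+1}{2}$ for $j=1,\dots,p-1$, and $$F_p(n)=\sum_{0\le j<p}(p-j)\,F_p\!\left(\left\lfloor\frac{n+j}{p}\right\rfloor\right)$$ holds for all $n\ge p$; in fact it holds for all $n\ge0$. *)

theory Defs
  imports "HOL-Computational_Algebra.Primes"
begin

text \<open>
  Binomial coefficients are counted by position: equal values occurring at different
  \<open>(m, k)\<close> in Pascal's triangle are counted separately.
\<close>

definition F :: "nat \<Rightarrow> nat \<Rightarrow> nat" where
  "F p n = card {(m, k). k \<le> m \<and> m < n \<and> \<not> p dvd (m choose k)}"

end

theory Submission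
  imports Defs "HOL-Number_Theory.Cong"
begin

text \<open>
  By Lucas's theorem, row \<open>p * q + s\<close> (with \<open>s < p\<close>) of Pascal's triangle has \<open>s + 1\<close> times as
  many entries prime to \<open>p\<close> as row \<open>q\<close>. When \<open>n = p * q + s\<close> is replaced by \<open>n + 1\<close>, the only
  quotient \<open>(n + j) div p\<close> that changes is the one for \<open>j = p - 1 - s\<close>. It grows from \<open>q\<close> to
  \<open>q + 1\<close> and has weight \<open>p - j = s + 1\<close>, so both sides of the recurrence grow by the same amount.
\<close>

text \<open>Coefficient form of (1 + x)^(n + p) = (1 + x)^n (1 + x^p) modulo \<open>p\<close>: in
  Vandermonde's sum only the terms \<open>i = 0\<close> and \<open>i = p\<close> survive. The guard
  \<open>p \<le> k\<close> matters because truncated subtraction would turn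
  \<open>n choose (k - p)\<close> into 1 for \<open>k < p\<close>.\<close>

lemma choose_add_prime_cong:
  fixes p :: nat
  assumes "prime p"
  shows "[(n + p) choose k = (n choose k) + (if p \<le> k then n choose (k - p) else 0)] (mod p)"
proof -
  have p: "p > 0" using assms prime_gt_0_nat by blast
  let ?f = "\<lambda>i. (p choose i) * (n choose (k - i))"
  have "[sum ?f {..k} = (\<Sum>i\<le>k. if i = 0 \<or> i = p then n choose (k - i) else 0)] (mod p)"
  proof (rule cong_sum)
    fix i assume "i \<in> {..k}"
    show "[?f i = (if i = 0 \<or> i = p then n choose (k - i) else 0)] (mod p)"
    proof (cases "i = 0 \<or> i = p \<or> i > p")
      case True
      then show ?thesis using p by (auto simp: binomial_eq_0)
    next
      case False
      then have "p dvd (p choose i)"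
        using assms by (intro dvd_choose_prime) auto
      then show ?thesis using False by (simp add: cong_0_iff)
    qed
  qed
  also have "(\<Sum>i\<le>k. if i = 0 \<or> i = p then n choose (k - i) else 0) =
      (\<Sum>i\<in>{..k} \<inter> {0, p}. n choose (k - i))"
    by (subst sum.inter_restrict) (auto intro!: sum.cong)
  also have "{..k} \<inter> {0, p} = (if p \<le> k then {0, p} else {0})"
    by auto
  also have "(\<Sum>i\<in>\<dots>. n choose (k - i)) =
      (n choose k) + (if p \<le> k then n choose (k - p) else 0)"
    using p by auto
  finally show ?thesis
    using vandermonde [of p n k] by (simp only: add.commute [of n p])
qed

text \<open>Lucas's theorem for the last base-\<open>p\<close> digit. Raising \<open>q\<close> by
  one adds \<open>p\<close> to the upper index, so the previous congruence becomes Pascal's rule for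
  \<open>Suc q choose a\<close>, multiplied by \<open>s choose b\<close>.\<close>

theorem lucas_binomial_cong:
  fixes p :: nat
  assumes "prime p" "s < p" "b < p"
  shows "[(p * q + s) choose (p * a + b) = (q choose a) * (s choose b)] (mod p)"
proof (induction q arbitrary: a)
  case 0
  then show ?case using assms by (cases a) (auto simp: binomial_eq_0)
next
  case (Suc q)
  have "[(p * q + s + p) choose (p * a + b) = ((p * q + s) choose (p * a + b)) +
      (if p \<le> p * a + b then (p * q + s) choose (p * a + b - p) else 0)] (mod p)"
    by (rule choose_add_prime_cong [OF assms(1)])
  also have "[((p * q + s) choose (p * a + b)) +
      (if p \<le> p * a + b then (p * q + s) choose (p * a + b - p) else 0) = (q choose a) * (s choose b) +
      (if a = 0 then 0 else (q choose (a - 1)) * (s choose b))] (mod p)"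
  proof (rule cong_add [OF Suc.IH])
    show "[(if p \<le> p * a + b then (p * q + s) choose (p * a + b - p) else 0) =
        (if a = 0 then 0 else (q choose (a - 1)) * (s choose b))] (mod p)"
      \<comment> \<open>For \<open>a = 0\<close>, \<open>b < p\<close> makes the left guard false;
        otherwise subtracting \<open>p\<close> lowers \<open>a\<close> by one.\<close>
      using Suc.IH [of "a - 1"] assms(3) by (cases a) simp_all
  qed
  also have "(q choose a) * (s choose b) +
      (if a = 0 then 0 else (q choose (a - 1)) * (s choose b)) = (Suc q choose a) * (s choose b)"
    by (cases a) (simp_all add: algebra_simps)
  finally show ?case by (simp add: algebra_simps)
qed

text \<open>For \<open>b \<le> s < p\<close> the factor \<open>s choose b\<close> divides
  \<open>fact s\<close>, which is prime to \<open>p\<close>; for \<open>s < b\<close> it is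
  zero.\<close>

lemma prime_dvd_choose_iff:
  fixes p :: nat
  assumes "prime p" "s < p" "b < p"
  shows "p dvd ((p * q + s) choose (p * a + b)) \<longleftrightarrow> p dvd (q choose a) \<or> s < b"
proof -
  have "\<not> p dvd (s choose b)" if "b \<le> s"
  proof
    assume "p dvd (s choose b)"
    then have "p dvd fact s"
      using binomial_fact_lemma [OF that] by (metis dvd_mult)
    then show False
      using assms by (simp add: prime_dvd_fact_iff)
  qed
  moreover have "p dvd (s choose b)" if "s < b"
    using that by (simp add: binomial_eq_0)
  ultimately show ?thesis
    using cong_dvd_iff [OF lucas_binomial_cong [OF assms, of q a]] assms(1)
    by (auto simp: prime_dvd_mult_iff not_less)
qed

text \<open>The bound \<open>k \<le> m\<close> is implicit: beyond the row the coefficient is 0,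
  hence divisible by \<open>p\<close>.\<close>

definition row_nondiv :: "nat \<Rightarrow> nat \<Rightarrow> nat set" where
  "row_nondiv p m = {k. \<not> p dvd (m choose k)}"

lemma row_nondiv_subset: "row_nondiv p m \<subseteq> {..m}"
  by (auto simp: row_nondiv_def) (metis binomial_eq_0 dvd_0_right not_le)

lemma finite_row_nondiv [simp]: "finite (row_nondiv p m)"
  using row_nondiv_subset finite_subset by blast

text \<open>Splitting \<open>k\<close> into quotient \<open>a\<close> and last digit
  \<open>b\<close> gives a bijection: \<open>a\<close> ranges over the entries of row
  \<open>q\<close>, and \<open>b\<close> over the \<open>s + 1\<close> digits up to
  \<open>s\<close>.\<close>

lemma card_row_nondiv:
  fixes p :: nat
  assumes "prime p" "s < p"
  shows "card (row_nondiv p (p * q + s)) = (s + 1) * card (row_nondiv p q)"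
proof -
  have "bij_betw (\<lambda>(a, b). p * a + b) (row_nondiv p q \<times> {..s}) (row_nondiv p (p * q + s))"
  proof (rule bij_betw_byWitness [where f' = "\<lambda>k. (k div p, k mod p)"])
    show "(\<lambda>k. (k div p, k mod p)) ` row_nondiv p (p * q + s) \<subseteq> row_nondiv p q \<times> {..s}"
    proof (rule image_subsetI)
      fix k assume "k \<in> row_nondiv p (p * q + s)"
      moreover have "k mod p < p" "p * (k div p) + k mod p = k" using assms by simp_all
      ultimately show "(k div p, k mod p) \<in> row_nondiv p q \<times> {..s}"
        using prime_dvd_choose_iff [OF assms, of "k mod p" q "k div p"]
        by (auto simp: row_nondiv_def)
    qed
  qed (use assms in \<open>auto simp: row_nondiv_def prime_dvd_choose_iff\<close>)
  from bij_betw_same_card [OF this] show ?thesis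
    by (simp add: card_cartesian_product mult.commute)
qed

lemma card_row_nondiv_less:
  assumes "prime p" "m < p"
  shows "card (row_nondiv p m) = m + 1"
proof -
  have "k = 0" if "\<not> p dvd (0 choose k)" for k
    using that by (cases k) auto
  then have "row_nondiv p 0 = {0}"
    using assms by (auto simp: row_nondiv_def)
  then show ?thesis using card_row_nondiv [OF assms, of 0] by simp
qed

lemma F_eq_sum: "F p n = (\<Sum>m<n. card (row_nondiv p m))"
proof -
  have "{(m, k). k \<le> m \<and> m < n \<and> \<not> p dvd (m choose k)} = Sigma {..<n} (row_nondiv p)"
    using row_nondiv_subset by (fastforce simp: row_nondiv_def)
  then show ?thesis by (simp add: F_def)
qed

lemma F_0: "F p 0 = 0"
  by (simp add: F_eq_sum)

lemma F_Suc: "F p (Suc n) = F p n + card (row_nondiv p n)"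
  by (simp add: F_eq_sum)

text \<open>Rows below \<open>p\<close> contribute all their \<open>m + 1\<close> entries, which
  gives triangular numbers; \<open>n = p\<close> is included since \<open>F p n\<close> counts only
  rows below \<open>n\<close>.\<close>

lemma F_le_prime:
  assumes "prime p" "n \<le> p"
  shows "F p n = (n + 1) choose 2"
  using assms(2)
proof (induction n)
  case 0
  then show ?case by (simp add: F_0)
next
  case (Suc n)
  then show ?case
    using card_row_nondiv_less [OF assms(1), of n] by (simp add: F_Suc numeral_2_eq_2)
qed

lemma Suc_div_add:
  fixes p q s j :: nat
  assumes "s < p" "j < p"
  shows "(Suc (p * q + s) + j) div p =
    (if j = p - 1 - s then Suc ((p * q + s + j) div p) else (p * q + s + j) div p)"
proof -
  have "p dvd Suc (p * q + s + j) \<longleftrightarrow> p dvd Suc (s + j)"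
    by (metis add.assoc add_Suc_right dvd_add_right_iff dvd_triv_left)
  also have "\<dots> \<longleftrightarrow> j = p - 1 - s"
  proof
    assume "p dvd Suc (s + j)"
    then obtain c where c: "Suc (s + j) = p * c" by blast
    \<comment> \<open>\<open>Suc (s + j)\<close> is positive and below \<open>2 * p\<close>, so the
      only possible multiple is \<open>p\<close> itself.\<close>
    moreover have "c < 2" using c assms mult_le_mono2 [of 2 c p] by linarith
    moreover have "c \<noteq> 0" using c by (cases "c = 0") simp_all
    ultimately have "c = 1" by linarith
    then show "j = p - 1 - s" using c by simp
  qed (use assms in auto)
  finally show ?thesis by (simp add: div_Suc dvd_eq_mod_eq_0)
qed

lemma F_recurrence:
  assumes "prime p"
  shows "F p n = (\<Sum>j<p. (p - j) * F p ((n + j) div p))"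
proof (induction n)
  case 0
  \<comment> \<open>Every quotient \<open>j div p\<close> with \<open>j < p\<close> is 0, so the sum
    vanishes.\<close>
  then show ?case by (simp add: F_0)
next
  case (Suc n)
  define q s where "q = n div p" and "s = n mod p"
  have n: "n = p * q + s" and s: "s < p"
    using assms prime_gt_0_nat by (auto simp: q_def s_def)
  \<comment> \<open>The dividend is \<open>p * q + (p - 1)\<close>, the last number with quotient
    \<open>q\<close>.\<close>
  have q: "(n + (p - 1 - s)) div p = q"
    using s by (intro div_nat_eqI) (simp_all add: n algebra_simps)
  have "(\<Sum>j<p. (p - j) * F p ((Suc n + j) div p)) =
      (\<Sum>j<p. (p - j) * F p ((n + j) div p) +
        (if j = p - 1 - s then (s + 1) * card (row_nondiv p q) else 0))"
  proof (rule sum.cong [OF refl])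
    fix j assume "j \<in> {..<p}"
    then have "(Suc n + j) div p =
        (if j = p - 1 - s then Suc ((n + j) div p) else (n + j) div p)"
      using Suc_div_add [OF s] n by auto
    moreover have "p - (p - 1 - s) = s + 1" using s by simp
    ultimately show "(p - j) * F p ((Suc n + j) div p) = (p - j) * F p ((n + j) div p) +
        (if j = p - 1 - s then (s + 1) * card (row_nondiv p q) else 0)"
      using q by (simp add: F_Suc distrib_left)
  qed
  also have "\<dots> = F p n + (s + 1) * card (row_nondiv p q)"
    using s by (simp add: sum.distrib Suc.IH [symmetric])
  also have "\<dots> = F p (Suc n)"
    using card_row_nondiv [OF assms s, of q] n by (simp add: F_Suc)
  finally show ?case by simp
qed

theorem theorem2p1:
  fixes p :: nat
  assumes "prime p"
  shows "F p 0 = 0 \<and>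
    (\<forall>j\<in>{1..p - 1}. F p j = (j + 1) choose 2) \<and>
    (\<forall>n. F p n = (\<Sum>j<p. (p - j) * F p ((n + j) div p)))"
proof (intro conjI ballI allI)
  show "F p 0 = 0" by (rule F_0)
  show "F p j = (j + 1) choose 2" if "j \<in> {1..p - 1}" for j
    using that by (intro F_le_prime [OF assms]) auto
  show "F p n = (\<Sum>j<p. (p - j) * F p ((n + j) div p))" for n
    by (rule F_recurrence [OF assms])
qed

end
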